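(* Let $S=(\{(z_i,v_i)\}_{i\in\mathcal I},\{(x_k,\delta_k)\}_{k\in\mathcal K})$ be a set of observations with $z_i,x_k\in\mathbb R^d$, $v_i\in\mathbb R^d\setminus\{0\}$ and $\delta_k\ge 0$, with $\mathcal I,\mathcal K$ finite. If $\alpha=0$ or $D\ge\frac2\alpha$, then $S$ is $\mathcal C_{\alpha,\beta,D}$-interpolable if and only if $S\in\mathrm{Interp}(\alpha,\beta,D;1)$.
   Context: Sets. $\langle\cdot,\cdot\rangle$, $\|\cdot\|$ are the Euclidean inner product and norm on $\mathbb R^d$; $B(x,r)$ is the closed ball of radius $r$ centered at $x$. For a nonempty closed convex $C\subseteq\mathbb R^d$: $N_C(z)=\{v:\langle v,x-z\rangle\le 0\ \forall x\in C\}$ is the normal cone at $z\in\mathrm{bdry}\,C$; $\mathrm{diam}(C)=\sup\{\|x-y\|:x,y\in C\}$; $\mathrm{int}_\delta C=\{x: B(x,\delta)\subseteq C\}$ (so $\mathrm{int}_0C=C$). $C$ is $\beta$-smooth if $B(z-\frac1\beta n,\frac1\beta)\subseteq C$ for every $z\in\mathrm{bdry}\,C$ and unit vector $n\in N_C(z)$; $C$ is $\alpha$-strongly convex if $B(z-\frac1\alpha n,\frac1\alpha)\supseteq C$ for every $z\in\mathrm{bdry}\,C$ and unit $n\in N_C(z)$. Limiting values are allowed: every closed convex set is $\infty$-smooth and $0$-strongly convex, and the only $\infty$-strongly convex sets are singletons. $\mathcal C_{\alpha,\beta,D}$ is the set of nonempty closed convex sets that are $\alpha$-strongly convex, $\beta$-smooth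 and have $\mathrm{diam}(C)\le D$. Interpolability. $S$ is $\mathcal C_{\alpha,\beta,D}$-interpolable if there exists $C\in\mathcal C_{\alpha,\beta,D}$ with $z_i\in C$ and $v_i\in N_C(z_i)$ for all $i\in\mathcal I$, and $x_k\in\mathrm{int}_{\delta_k}C$ for all $k\in\mathcal K$. The index sets $\mathcal I,\mathcal K$ need not have the same size nor both be nonempty. Conditions. Parameters: $0\le\alpha\le\beta\le\infty$, $\beta>0$, $D\in[0,\infty]$, with $1/\infty=0$. Put $n_i=v_i/\|v_i\|$, $\gamma=(\frac1\alpha-\frac1\beta)^{-1}$ (with $\frac1\gamma=0$ if $\alpha=\beta$), $s_k=\max\{0,\delta_k-\frac1\beta\}$. For $\lambda\in[\frac1{\sqrt2},1]$, write $S\in\mathrm{Interp}(\alpha,\beta,D;\lambda)$ if there exist $\{w_k\}_{k\in\mathcal K}\subset\mathbb R^d$ such that for all $i,j\in\mathcal I$ and $k,l\in\mathcal K$: (1) $\|z_i-\frac1\alpha n_i-(z_j-\frac1\beta n_j)\|\le\frac1\gamma$; (2) $\|z_i-\frac1\alpha n_i-w_k\|\le\frac1\gamma-s_k$; (3) $\|x_k-w_k\|\le\frac1\beta-\delta_k+s_k$; (4) $\|z_i-\frac1\beta n_i-(z_j-\frac1\beta n_j)\|\le\lambda(D-\frac2\beta)$; (5) $\|z_i-\frac1\beta n_i-w_k\|\le\lambda(D-\frac2\beta)-s_k$; (6) $\|w_k-w_l\|\le\lambda(D-\frac2\beta)-s_k-s_l$. If $\alpha=0$, conditions (1) and (2)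 are understood as their limits as $\alpha\to0$: $\langle n_i,z_j-\frac1\beta n_j-z_i+\frac1\beta n_i\rangle\le0$ and $\langle n_i,w_k+s_kn_i-z_i+\frac1\beta n_i\rangle\le0$. If $D=\infty$, (4)-(6) are vacuous.
   Formalization: The claim can fail when the index set I is empty, so it is proved with two added assumptions: if I and K are both empty, then D ≥ 2/β; if I is empty and K is not, then either α = 0, or α < ∞ and D = ∞. *)

theory Defs
  imports "HOL-Analysis.Analysis"
begin

text \<open>
  The parameters $\alpha$, $\beta$, $D$ range over $[0,\infty]$ and have type \<^typ>\<open>ennreal\<close>.
  The real number $1/r$ for $r \in (0,\infty]$ is \<open>recip r\<close>, so that \<open>recip \<infinity> = 0\<close>.
  The value at \<open>r = 0\<close> is irrelevant: that case is always treated separately or excluded.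
\<close>

definition recip :: "ennreal \<Rightarrow> real" where
  "recip r = enn2real (1 / r)"

definition normal_cone :: "'a::euclidean_space set \<Rightarrow> 'a \<Rightarrow> 'a set" where
  "normal_cone C z = {v. \<forall>x\<in>C. v \<bullet> (x - z) \<le> 0}"

text \<open>
  Meant for $\beta > 0$. For $\beta = \infty$ the balls are the singletons \<open>{z}\<close>, so that every
  closed set satisfies the condition.
\<close>

definition smooth_set :: "ennreal \<Rightarrow> 'a::euclidean_space set \<Rightarrow> bool" where
  "smooth_set \<beta> C \<longleftrightarrow>
     (\<forall>z\<in>frontier C. \<forall>n\<in>normal_cone C z. norm n = 1 \<longrightarrow>
        cball (z - recip \<beta> *\<^sub>R n) (recip \<beta>) \<subseteq> C)"

definition strongly_convex_set :: "ennreal \<Rightarrow> 'a::euclidean_space set \<Rightarrow> bool" where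
  "strongly_convex_set \<alpha> C \<longleftrightarrow>
     (if \<alpha> = 0 then True
      else if \<alpha> = \<infinity> then (\<exists>z. C = {z})
      else (\<forall>z\<in>frontier C. \<forall>n\<in>normal_cone C z. norm n = 1 \<longrightarrow>
              C \<subseteq> cball (z - recip \<alpha> *\<^sub>R n) (recip \<alpha>)))"

text \<open>Unlike \<^const>\<open>diameter\<close>, this takes the value \<open>\<infinity>\<close> on unbounded sets.\<close>

definition ediam :: "'a::euclidean_space set \<Rightarrow> ennreal" where
  "ediam C = (SUP x\<in>C. SUP y\<in>C. ennreal (norm (x - y)))"

definition inner_parallel :: "real \<Rightarrow> 'a::euclidean_space set \<Rightarrow> 'a set" where
  "inner_parallel \<delta> C = {x. cball x \<delta> \<subseteq> C}"

definition convex_class :: "ennreal \<Rightarrow> ennreal \<Rightarrow> ennreal \<Rightarrow> 'a::euclidean_space set set" where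
  "convex_class \<alpha> \<beta> D =
     {C. C \<noteq> {} \<and> closed C \<and> convex C \<and>
         strongly_convex_set \<alpha> C \<and> smooth_set \<beta> C \<and> ediam C \<le> D}"

text \<open>
  A set of observations is given by the families $(z_i, v_i)_{i \in I}$ and
  $(x_k, \delta_k)_{k \in K}$.
\<close>

definition interpolable ::
  "ennreal \<Rightarrow> ennreal \<Rightarrow> ennreal \<Rightarrow>
   'i set \<Rightarrow> ('i \<Rightarrow> 'a::euclidean_space) \<Rightarrow> ('i \<Rightarrow> 'a) \<Rightarrow>
   'k set \<Rightarrow> ('k \<Rightarrow> 'a) \<Rightarrow> ('k \<Rightarrow> real) \<Rightarrow> bool" where
  "interpolable \<alpha> \<beta> D I z v K x \<delta> \<longleftrightarrow>
     (\<exists>C\<in>convex_class \<alpha> \<beta> D.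
        (\<forall>i\<in>I. z i \<in> C \<and> v i \<in> normal_cone C (z i)) \<and>
        (\<forall>k\<in>K. x k \<in> inner_parallel (\<delta> k) C))"

text \<open>
  Below, \<open>a\<close>, \<open>b\<close>, \<open>g\<close> stand for $1/\alpha$, $1/\beta$, $1/\gamma = 1/\alpha - 1/\beta$ (which is
  $0$ if $\alpha = \beta$, also for $\alpha = \beta = \infty$), and \<open>d\<close> stands for $D - 2/\beta$, a
  real number that may be negative. The numbers \<open>a\<close>, \<open>g\<close> are used only if $\alpha > 0$, and \<open>d\<close>
  only if $D < \infty$.
\<close>

definition Interp ::
  "ennreal \<Rightarrow> ennreal \<Rightarrow> ennreal \<Rightarrow> real \<Rightarrow>
   'i set \<Rightarrow> ('i \<Rightarrow> 'a::euclidean_space) \<Rightarrow> ('i \<Rightarrow> 'a) \<Rightarrow>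
   'k set \<Rightarrow> ('k \<Rightarrow> 'a) \<Rightarrow> ('k \<Rightarrow> real) \<Rightarrow> bool" where
  "Interp \<alpha> \<beta> D lam I z v K x \<delta> \<longleftrightarrow>
     (let a = recip \<alpha>; b = recip \<beta>; g = a - b; d = enn2real D - 2 * b;
          n = (\<lambda>i. (1 / norm (v i)) *\<^sub>R v i);
          s = (\<lambda>k. max 0 (\<delta> k - b))
      in \<exists>w :: 'k \<Rightarrow> 'a.
        (\<forall>i\<in>I. \<forall>j\<in>I.
           if \<alpha> = 0 then n i \<bullet> (z j - b *\<^sub>R n j - z i + b *\<^sub>R n i) \<le> 0
           else norm (z i - a *\<^sub>R n i - (z j - b *\<^sub>R n j)) \<le> g) \<and>
        (\<forall>i\<in>I. \<forall>k\<in>K.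
           if \<alpha> = 0 then n i \<bullet> (w k + s k *\<^sub>R n i - z i + b *\<^sub>R n i) \<le> 0
           else norm (z i - a *\<^sub>R n i - w k) \<le> g - s k) \<and>
        (\<forall>k\<in>K. norm (x k - w k) \<le> b - \<delta> k + s k) \<and>
        (D < \<infinity> \<longrightarrow>
           (\<forall>i\<in>I. \<forall>j\<in>I. norm (z i - b *\<^sub>R n i - (z j - b *\<^sub>R n j)) \<le> lam * d) \<and>
           (\<forall>i\<in>I. \<forall>k\<in>K. norm (z i - b *\<^sub>R n i - w k) \<le> lam * d - s k) \<and>
           (\<forall>k\<in>K. \<forall>l\<in>K. norm (w k - w l) \<le> lam * d - s k - s l)))"

end

theory Submission
  imports Defs
begin

text \<open>
  Write \<open>a = 1/\<alpha>\<close>, \<open>b = 1/\<beta>\<close>, \<open>g = a - b\<close>. A \<open>\<beta>\<close>-smooth convex set is a union of balls of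
  radius \<open>b\<close>, hence it is the outer parallel set at distance \<open>b\<close> of a convex core, and the
  conditions of \<^const>\<open>Interp\<close> say that the core behaves well with respect to the points
  \<open>z\<^sub>i - b n\<^sub>i\<close> and the balls of centre \<open>w\<^sub>k\<close> and radius \<open>s\<^sub>k\<close>.

  Necessity. Smoothness puts the balls of radius \<open>b\<close> around \<open>z\<^sub>i - b n\<^sub>i\<close> into \<open>C\<close>. For an
  observation \<open>x\<^sub>k\<close> with \<open>\<delta>\<^sub>k < b\<close> one moves \<open>x\<^sub>k\<close> inwards, away from its nearest boundary point,
  until the ball around it has radius \<open>b\<close> (\<open>smooth_set_retreat\<close>); this is the choice of \<open>w\<^sub>k\<close>.
  All the inequalities then express that these balls lie in the ball
  \<open>B(z\<^sub>i - a n\<^sub>i, a)\<close>, or in a supporting half-space if \<open>\<alpha> = 0\<close>, and that two balls inside \<open>C\<close>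
  contain points whose distance is the sum of the radii and the distance of the centres.

  Sufficiency. If \<open>\<alpha> > 0\<close>, the core is the intersection of the balls \<open>B(z\<^sub>i - a n\<^sub>i, g)\<close>. Any
  intersection of balls of radius \<open>g\<close> is strongly convex with radius \<open>g\<close>
  (\<open>Inter_cball_strongly_convex\<close>), so its outer parallel set is strongly convex with radius \<open>a\<close>.
  That set lies in a ball of radius \<open>a\<close>, so its diameter is at most \<open>2 / \<alpha> \<le> D\<close>: this is why
  the bound on the diameter interacts with the other conditions only if \<open>\<alpha> = 0\<close>. In that case the
  core is the convex hull of all points \<open>z\<^sub>i - b n\<^sub>i\<close> and balls \<open>B(w\<^sub>k, s\<^sub>k)\<close>; passing to the hull
  neither leaves the supporting half-spaces nor increases the diameter.

  If \<open>\<alpha> > 0\<close> and there are no observations of boundary points, the intersection above is the whole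
  space, which has no boundary and satisfies both curvature conditions vacuously; it belongs to the
  class if \<open>\<alpha> < \<infinity>\<close> and \<open>D = \<infinity>\<close>. If there are no observations at all, a ball of radius \<open>b\<close> is a
  member of least diameter.
\<close>

section \<open>Reciprocals of extended parameters\<close>

lemma recip_nonneg: "0 \<le> recip r"
  by (simp add: recip_def)

lemma recip_antimono:
  assumes "r \<le> s" "r \<noteq> 0"
  shows "recip s \<le> recip r"
  unfolding recip_def
proof (rule enn2real_mono)
  have "inverse s \<le> inverse r"
    using assms(1) ereal_inverse_antimono[OF enn2ereal_nonneg]
    by (simp add: less_eq_ennreal.rep_eq inverse_ennreal.rep_eq)
  then show "1 / s \<le> 1 / r"
    by (simp add: divide_ennreal_def)
  show "1 / r < top"
    using assms(2) by (simp add: less_top[symmetric] ennreal_divide_eq_top_iff)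
qed

lemma ennreal_double_recip:
  assumes "r \<noteq> 0"
  shows "ennreal (2 * recip r) = 2 / r"
proof -
  have "1 / r < top"
    using assms by (simp add: less_top[symmetric] ennreal_divide_eq_top_iff)
  then have "ennreal (2 * recip r) = 2 * (1 / r)"
    by (simp add: recip_def ennreal_mult')
  then show ?thesis
    by (simp add: ennreal_times_divide)
qed

section \<open>Diameter and inscribed balls\<close>

lemma ediam_le_ennreal:
  assumes "\<And>x y. x \<in> C \<Longrightarrow> y \<in> C \<Longrightarrow> norm (x - y) \<le> e"
  shows "ediam C \<le> ennreal e"
  unfolding ediam_def using assms by (intro SUP_least ennreal_leI) auto

lemma norm_diff_le_ediam:
  assumes "ediam C \<le> D" "D < \<infinity>" "x \<in> C" "y \<in> C"
  shows "norm (x - y) \<le> enn2real D"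
proof -
  have "ennreal (norm (x - y)) \<le> ediam C"
    unfolding ediam_def using assms(3,4) by (meson SUP_upper SUP_upper2)
  also have "\<dots> \<le> ennreal (enn2real D)"
    using assms(1,2) by simp
  finally show ?thesis
    by (simp add: ennreal_le_iff)
qed

text \<open>
  The extreme distance is attained on the line through the two centres; if these coincide, any
  direction does.
\<close>

lemma inscribed_balls_ediam:
  fixes p q :: "'a::euclidean_space"
  assumes "cball p r \<subseteq> C" "cball q s \<subseteq> C" "0 \<le> r" "0 \<le> s" "ediam C \<le> D" "D < \<infinity>"
  shows "norm (p - q) + r + s \<le> enn2real D"
proof -
  obtain e where e: "norm e = 1" "p - q = norm (p - q) *\<^sub>R e"
  proof (cases "p = q")
    case True
    obtain e :: 'a where "norm e = 1"
      using vector_choose_size[of 1] by auto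
    with True that show ?thesis by simp
  next
    case False
    then show ?thesis
      by (intro that[of "(p - q) /\<^sub>R norm (p - q)"]) auto
  qed
  have "norm ((p + r *\<^sub>R e) - (q - s *\<^sub>R e)) \<le> enn2real D"
    using assms e(1) by (intro norm_diff_le_ediam[of C]) (auto simp: dist_norm subset_eq)
  moreover have "(p + r *\<^sub>R e) - (q - s *\<^sub>R e) = (norm (p - q) + r + s) *\<^sub>R e"
    using e(2) by (simp add: algebra_simps)
  ultimately show ?thesis
    using e(1) assms(3,4) by simp
qed

lemma inscribed_ball_centre:
  fixes p q :: "'a::euclidean_space"
  assumes "cball p r \<subseteq> C" "C \<subseteq> cball q R" "0 \<le> r"
  shows "norm (q - p) \<le> R - r"
proof -
  have "dist p q + r \<le> R"
    using assms cball_subset_cball_iff[of p r q R] by force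
  then show ?thesis
    by (simp add: dist_norm norm_minus_commute)
qed

section \<open>Normal vectors\<close>

text \<open>The equality case of the Cauchy-Schwarz inequality.\<close>

lemma eq_scaleR_if_inner_ge:
  fixes u n :: "'a::euclidean_space"
  assumes "norm n = 1" "norm u \<le> b" "b \<le> n \<bullet> u"
  shows "u = b *\<^sub>R n"
proof -
  have "0 \<le> b"
    using assms(2) norm_ge_zero[of u] by linarith
  then have "u \<bullet> u \<le> b * b"
    using mult_mono[OF assms(2,2)]
    by (simp add: power2_norm_eq_inner[symmetric] power2_eq_square)
  moreover have "b * b \<le> b * (n \<bullet> u)"
    using assms(3) \<open>0 \<le> b\<close> by (rule mult_left_mono)
  moreover have "n \<bullet> n = 1"
    using assms(1) by (simp add: norm_eq_1)
  ultimately have "(u - b *\<^sub>R n) \<bullet> (u - b *\<^sub>R n) \<le> 0"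
    by (simp add: inner_simps inner_commute algebra_simps)
  then have "u - b *\<^sub>R n = 0"
    using inner_gt_zero_iff[of "u - b *\<^sub>R n"] by linarith
  then show ?thesis
    by simp
qed

lemma unit_normal_exists:
  fixes C :: "'a::euclidean_space set"
  assumes "convex C" "closed C" "z \<in> frontier C"
  obtains n where "norm n = 1" "n \<in> normal_cone C z"
proof -
  have zC: "z \<in> C" and zi: "z \<notin> interior C"
    using assms by (auto simp: frontier_def)
  obtain m where m: "m \<noteq> 0" "\<And>y. y \<in> C \<Longrightarrow> m \<bullet> y \<le> m \<bullet> z"
  proof (cases "interior C = {}")
    case True
    obtain m c where "m \<noteq> 0" "C \<subseteq> {y. m \<bullet> y = c}"
      using empty_interior_subset_hyperplane[OF assms(1) True] by blast
    with zC show ?thesis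
      by (intro that[of m]) (auto simp: subset_eq)
  next
    case False
    obtain m c where m: "m \<noteq> 0" "\<forall>y\<in>interior C. m \<bullet> y \<le> c" "\<forall>y\<in>{z}. c \<le> m \<bullet> y"
      using separating_hyperplane_sets[of "interior C" "{z}"] False zi assms(1)
      by (auto simp: convex_interior)
    have "closure (interior C) \<subseteq> {y. m \<bullet> y \<le> m \<bullet> z}"
      using m by (intro closure_minimal closed_halfspace_le) force
    then have "C \<subseteq> {y. m \<bullet> y \<le> m \<bullet> z}"
      using convex_closure_interior[OF assms(1) False] assms(2) by simp
    with m(1) show ?thesis
      by (intro that[of m]) auto
  qed
  show ?thesis
    using m by (intro that[of "m /\<^sub>R norm m"])
      (auto simp: normal_cone_def inner_diff_right mult_left_mono divide_simps)
qed

lemma frontier_if_nonzero_normal: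
  fixes C :: "'a::euclidean_space set"
  assumes "z \<in> C" "v \<in> normal_cone C z" "v \<noteq> 0"
  shows "z \<in> frontier C"
proof -
  have "z \<notin> interior C"
  proof
    assume "z \<in> interior C"
    then obtain e where e: "0 < e" "cball z e \<subseteq> C"
      by (auto simp: mem_interior_cball)
    have "z + (e / norm v) *\<^sub>R v \<in> C"
      using e assms(3) by (auto simp: dist_norm subset_eq)
    then have "(e / norm v) * (v \<bullet> v) \<le> 0"
      using assms(2) unfolding normal_cone_def by fastforce
    moreover have "0 < (e / norm v) * (v \<bullet> v)"
      using e assms(3) by simp
    ultimately show False by simp
  qed
  then show ?thesis
    using assms(1) closure_subset[of C] by (auto simp: frontier_def)
qed

text \<open>
  Write \<open>b = 1/\<beta>\<close>. If the ball of radius \<open>b\<close> around \<open>x\<close> leaves \<open>C\<close>, the boundary point \<open>z\<close>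
  nearest to \<open>x\<close> has distance \<open>r < b\<close>, and \<open>r \<ge> \<delta>\<close>. The normal of \<open>C\<close> at \<open>z\<close> is
  also normal to the inscribed ball of radius \<open>r\<close> around \<open>x\<close>, so \<open>x\<close> lies on the segment from \<open>z\<close>
  to the centre \<open>w\<close> of the ball of radius \<open>b\<close> that smoothness provides at \<open>z\<close>. In other words, the
  inner parallel sets of a smooth set at distances up to \<open>b\<close> arise from one another by adding balls.
\<close>

lemma smooth_set_retreat:
  fixes C :: "'a::euclidean_space set"
  assumes "convex C" "closed C" "smooth_set \<beta> C" "cball x \<delta> \<subseteq> C" "0 \<le> \<delta>" "\<delta> \<le> recip \<beta>"
  obtains w where "cball w (recip \<beta>) \<subseteq> C" "norm (x - w) \<le> recip \<beta> - \<delta>"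
proof (cases "cball x (recip \<beta>) \<subseteq> C")
  case True
  then show ?thesis
    using assms(6) by (intro that[of x]) auto
next
  case False
  define b where "b = recip \<beta>"
  have xC: "x \<in> C"
    using assms(4,5) by auto
  have "frontier C \<noteq> {}"
    using False xC frontier_eq_empty[of C] by auto
  then obtain z where z: "z \<in> frontier C" "\<And>y. y \<in> frontier C \<Longrightarrow> dist x z \<le> dist x y"
    using distance_attains_inf[of "frontier C" x] by auto
  define r where "r = dist x z"
  have r0: "0 \<le> r"
    by (simp add: r_def)
  have "cball x r \<subseteq> C"
  proof (cases "r = 0")
    case True
    then show ?thesis using xC by simp
  next
    case False
    with r0 have "0 < r" by simp
    have "ball x r \<inter> frontier C = {}"
      using z(2) by (force simp: r_def)
    moreover have "x \<in> ball x r \<inter> C"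
      using xC \<open>0 < r\<close> by simp
    ultimately have "ball x r \<subseteq> C"
      using connected_Int_frontier[OF connected_ball, of x r C] by blast
    then have "closure (ball x r) \<subseteq> C"
      using assms(2) by (rule closure_minimal)
    then show ?thesis
      using \<open>0 < r\<close> by simp
  qed
  have "r < b"
    using False \<open>cball x r \<subseteq> C\<close> subset_cball[of b r x] by (force simp: b_def)
  have "\<delta> \<le> r"
  proof (rule ccontr)
    assume "\<not> \<delta> \<le> r"
    then have "z \<in> ball x \<delta>"
      by (simp add: r_def)
    moreover have "ball x \<delta> \<subseteq> interior C"
      using assms(4) ball_subset_cball[of x \<delta>] by (intro interior_maximal) auto
    ultimately show False
      using z(1) by (auto simp: frontier_def)
  qed
  obtain n where n: "norm n = 1" "n \<in> normal_cone C z"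
    using unit_normal_exists[OF assms(1,2) z(1)] .
  have "x + r *\<^sub>R n \<in> C"
    using \<open>cball x r \<subseteq> C\<close> n(1) r0 by (auto simp: dist_norm subset_eq)
  then have "n \<bullet> (x + r *\<^sub>R n - z) \<le> 0"
    using n(2) by (simp add: normal_cone_def)
  then have "r \<le> n \<bullet> (z - x)"
    using n(1) by (simp add: inner_simps norm_eq_1)
  then have zx: "z - x = r *\<^sub>R n"
    using n(1) by (intro eq_scaleR_if_inner_ge) (auto simp: r_def dist_norm norm_minus_commute)
  have "cball (z - b *\<^sub>R n) b \<subseteq> C"
    using assms(3) z(1) n by (auto simp: smooth_set_def b_def)
  moreover have "x - (z - b *\<^sub>R n) = (b - r) *\<^sub>R n"
    using zx by (simp add: algebra_simps)
  then have "norm (x - (z - b *\<^sub>R n)) \<le> b - \<delta>"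
    using n(1) \<open>r < b\<close> \<open>\<delta> \<le> r\<close> by simp
  ultimately show ?thesis
    by (intro that[of "z - b *\<^sub>R n"]) (auto simp: b_def)
qed

section \<open>Outer parallel sets\<close>

definition outer_parallel :: "real \<Rightarrow> 'a::euclidean_space set \<Rightarrow> 'a set" where
  "outer_parallel b C = {y. \<exists>p\<in>C. norm (y - p) \<le> b}"

lemma outer_parallelI: "p \<in> C \<Longrightarrow> norm (y - p) \<le> b \<Longrightarrow> y \<in> outer_parallel b C"
  by (auto simp: outer_parallel_def)

lemma outer_parallel_eq_sums:
  "outer_parallel b C = (\<Union>x\<in>C. \<Union>y\<in>cball 0 b. {x + y})"
proof (intro equalityI subsetI)
  fix y
  assume "y \<in> outer_parallel b C"
  then obtain p where "p \<in> C" "norm (y - p) \<le> b"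
    by (auto simp: outer_parallel_def)
  then show "y \<in> (\<Union>x\<in>C. \<Union>y\<in>cball 0 b. {x + y})"
    by (intro UN_I[of p] UN_I[of "y - p"]) auto
qed (auto intro: outer_parallelI)

lemma convex_outer_parallel: "convex C \<Longrightarrow> convex (outer_parallel b C)"
  unfolding outer_parallel_eq_sums by (intro convex_sums) auto

lemma closed_outer_parallel: "closed C \<Longrightarrow> closed (outer_parallel b C)"
  unfolding outer_parallel_eq_sums by (intro closed_compact_sums) auto

lemma cball_subset_outer_parallel: "p \<in> C \<Longrightarrow> cball p b \<subseteq> outer_parallel b C"
  by (auto simp: outer_parallel_def dist_norm norm_minus_commute)

text \<open>
  Write \<open>z = p + u\<close> with \<open>p \<in> C\<close> and \<open>\<parallel>u\<parallel> \<le> b\<close>. A normal \<open>n\<close> of the parallel set at \<open>z\<close> is also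
  maximal at \<open>z\<close> on the ball of radius \<open>b\<close> around \<open>p\<close>, which forces \<open>u = b n\<close>.
\<close>

lemma normal_outer_parallel:
  assumes "z \<in> outer_parallel b C" "0 \<le> b" "norm n = 1" "n \<in> normal_cone (outer_parallel b C) z"
  shows "z - b *\<^sub>R n \<in> C" "n \<in> normal_cone C (z - b *\<^sub>R n)"
proof -
  have shift: "n \<bullet> (p + b *\<^sub>R n - z) \<le> 0" if "p \<in> C" for p
  proof -
    have "p + b *\<^sub>R n \<in> outer_parallel b C"
      using that assms(2,3) by (intro outer_parallelI[of p]) auto
    then show ?thesis
      using assms(4) by (simp add: normal_cone_def)
  qed
  obtain p where p: "p \<in> C" "norm (z - p) \<le> b"
    using assms(1) by (auto simp: outer_parallel_def)
  have "b \<le> n \<bullet> (z - p)"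
    using shift[OF p(1)] assms(3) by (simp add: inner_simps norm_eq_1)
  then have "z - p = b *\<^sub>R n"
    using eq_scaleR_if_inner_ge[OF assms(3) p(2)] by simp
  then have "z - b *\<^sub>R n = p"
    by (simp add: algebra_simps)
  with p(1) show "z - b *\<^sub>R n \<in> C" by simp
  show "n \<in> normal_cone C (z - b *\<^sub>R n)"
    using shift by (auto simp: normal_cone_def algebra_simps)
qed

lemma smooth_set_outer_parallel:
  assumes "closed C"
  shows "smooth_set \<beta> (outer_parallel (recip \<beta>) C)"
  unfolding smooth_set_def
proof (intro ballI impI)
  fix z n
  assume "z \<in> frontier (outer_parallel (recip \<beta>) C)"
    and n: "n \<in> normal_cone (outer_parallel (recip \<beta>) C) z" "norm n = 1"
  then have "z \<in> outer_parallel (recip \<beta>) C"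
    using closed_outer_parallel[OF assms] frontier_subset_closed by blast
  then show "cball (z - recip \<beta> *\<^sub>R n) (recip \<beta>) \<subseteq> outer_parallel (recip \<beta>) C"
    using normal_outer_parallel(1)[OF _ recip_nonneg n(2,1)] cball_subset_outer_parallel by blast
qed

text \<open>Adding a ball of radius \<open>b\<close> increases the radius of the enclosing balls by \<open>b\<close>.\<close>

lemma strongly_convex_set_outer_parallel:
  assumes "closed C" "0 \<le> b" "\<alpha> < \<infinity>"
    and core: "\<And>p n. p \<in> C \<Longrightarrow> norm n = 1 \<Longrightarrow> n \<in> normal_cone C p \<Longrightarrow>
      C \<subseteq> cball (p - (recip \<alpha> - b) *\<^sub>R n) (recip \<alpha> - b)"
  shows "strongly_convex_set \<alpha> (outer_parallel b C)"
proof -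
  have "outer_parallel b C \<subseteq> cball (z - recip \<alpha> *\<^sub>R n) (recip \<alpha>)"
    if z: "z \<in> frontier (outer_parallel b C)"
      and n: "n \<in> normal_cone (outer_parallel b C) z" "norm n = 1" for z n
  proof
    fix y
    assume "y \<in> outer_parallel b C"
    then obtain p where p: "p \<in> C" "norm (y - p) \<le> b"
      by (auto simp: outer_parallel_def)
    have "z \<in> outer_parallel b C"
      using z closed_outer_parallel[OF assms(1)] frontier_subset_closed by blast
    from normal_outer_parallel[OF this assms(2) n(2,1)]
    have "C \<subseteq> cball (z - b *\<^sub>R n - (recip \<alpha> - b) *\<^sub>R n) (recip \<alpha> - b)"
      using core n(2) by blast
    moreover have "z - b *\<^sub>R n - (recip \<alpha> - b) *\<^sub>R n = z - recip \<alpha> *\<^sub>R n"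
      by (simp add: algebra_simps)
    ultimately have "norm (p - (z - recip \<alpha> *\<^sub>R n)) \<le> recip \<alpha> - b"
      using p(1) by (auto simp: dist_norm norm_minus_commute)
    then have "norm ((y - p) + (p - (z - recip \<alpha> *\<^sub>R n))) \<le> recip \<alpha>"
      using p(2) by (intro norm_triangle_le) linarith
    then have "norm (y - (z - recip \<alpha> *\<^sub>R n)) \<le> recip \<alpha>"
      by (simp only: add_diff_eq diff_add_cancel)
    then show "y \<in> cball (z - recip \<alpha> *\<^sub>R n) (recip \<alpha>)"
      by (simp add: dist_norm norm_minus_commute)
  qed
  then show ?thesis
    using assms(3) by (auto simp: strongly_convex_set_def)
qed

lemma ediam_outer_parallel:
  assumes "\<And>p q. p \<in> C \<Longrightarrow> q \<in> C \<Longrightarrow> norm (p - q) \<le> d"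
  shows "ediam (outer_parallel b C) \<le> ennreal (d + 2 * b)"
proof (rule ediam_le_ennreal)
  fix x y
  assume "x \<in> outer_parallel b C" "y \<in> outer_parallel b C"
  then obtain p q where "p \<in> C" "norm (x - p) \<le> b" "q \<in> C" "norm (y - q) \<le> b"
    by (auto simp: outer_parallel_def)
  moreover have "norm (x - y) \<le> norm (x - p) + norm (p - q) + norm (y - q)"
    using norm_triangle_ineq[of "x - p" "p - q"] norm_triangle_ineq[of "x - q" "q - y"]
      norm_minus_commute[of q y] by simp
  ultimately show "norm (x - y) \<le> d + 2 * b"
    using assms[of p q] by linarith
qed

section \<open>Intersections of balls of equal radius\<close>

text \<open>
  Let \<open>r > 0\<close>. A ball of radius \<open>r\<close> that contains \<open>p\<close> and \<open>x\<close> also contains, around the point dividing the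
  segment in the ratio \<open>t\<close> to \<open>1 - t\<close>, the ball of radius \<open>t (1 - t) \<parallel>x - p\<parallel>\<^sup>2 / (2 r)\<close>. The same
  holds for an intersection of such balls. A normal \<open>n\<close> at \<open>p\<close> bounds these balls from above, and
  letting \<open>t\<close> tend to \<open>0\<close> gives \<open>n \<bullet> (x - p) + \<parallel>x - p\<parallel>\<^sup>2 / (2 r) \<le> 0\<close>, which says that \<open>x\<close> is in
  the ball of radius \<open>r\<close> whose outer unit normal at \<open>p\<close> is \<open>n\<close>. This avoids computing the normal cone of
  the intersection.
\<close>

lemma Inter_cball_strongly_convex:
  fixes Q :: "'a::euclidean_space set"
  assumes "Q \<noteq> {}" "p \<in> (\<Inter>q\<in>Q. cball q r)" "norm n = 1"
    and "n \<in> normal_cone (\<Inter>q\<in>Q. cball q r) p"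
  shows "(\<Inter>q\<in>Q. cball q r) \<subseteq> cball (p - r *\<^sub>R n) r"
proof
  fix x
  assume x: "x \<in> (\<Inter>q\<in>Q. cball q r)"
  obtain q0 where "q0 \<in> Q"
    using assms(1) by auto
  then have p0: "dist q0 p \<le> r" and x0: "dist q0 x \<le> r"
    using assms(2) x by auto
  show "x \<in> cball (p - r *\<^sub>R n) r"
  proof (cases "r = 0")
    case True
    then show ?thesis using p0 x0 by simp
  next
    case False
    then have r: "0 < r"
      using p0 zero_le_dist[of q0 p] by linarith
    define h where "h = (x - p) \<bullet> (x - p)"
    have "s * (h / (2 * r)) \<le> - (n \<bullet> (x - p))" if s: "0 < s" "s < 1" for s
    proof -
      define t where "t = 1 - s"
      have t: "0 < t" "t < 1"
        using s by (auto simp: t_def)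
      define u where "u = p + t *\<^sub>R (x - p)"
      define \<rho> where "\<rho> = t * s * h / (2 * r)"
      have \<rho>: "2 * r * \<rho> = t * s * h"
        using r by (simp add: \<rho>_def)
      have \<rho>0: "0 \<le> \<rho>"
        using t s r by (simp add: \<rho>_def h_def)
      have "u + \<rho> *\<^sub>R n \<in> cball q r" if "q \<in> Q" for q
      proof -
        have "norm (p - q) \<le> r" "norm (x - q) \<le> r"
          using assms(2) x that by (auto simp: dist_norm norm_minus_commute)
        then have sq: "(p - q) \<bullet> (p - q) \<le> r\<^sup>2" "(x - q) \<bullet> (x - q) \<le> r\<^sup>2"
          by (auto simp: power2_norm_eq_inner[symmetric] intro!: power_mono)
        have "(u - q) \<bullet> (u - q) = s * ((p - q) \<bullet> (p - q)) + t * ((x - q) \<bullet> (x - q)) - t * s * h"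
          unfolding u_def h_def t_def
          by (simp add: inner_simps inner_commute algebra_simps)
        also have "\<dots> \<le> s * r\<^sup>2 + t * r\<^sup>2 - t * s * h"
          using sq s t by (intro diff_right_mono add_mono mult_left_mono) auto
        also have "\<dots> = r\<^sup>2 - 2 * r * \<rho>"
          using \<rho> by (simp add: t_def algebra_simps)
        finally have u: "(norm (u - q))\<^sup>2 \<le> r\<^sup>2 - 2 * r * \<rho>"
          by (simp add: power2_norm_eq_inner)
        have "2 * r * \<rho> \<le> r * r"
          using order_trans[OF zero_le_power2 u] by (simp add: power2_eq_square)
        then have "\<rho> \<le> r"
          using r \<rho>0 by (simp add: mult.assoc mult_le_cancel_left_pos mult.left_commute)
        have "(norm (u - q))\<^sup>2 \<le> (r - \<rho>)\<^sup>2"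
          using u zero_le_power2[of \<rho>] unfolding power2_diff by linarith
        then have "norm (u - q) \<le> r - \<rho>"
          by (rule power2_le_imp_le) (simp add: \<open>\<rho> \<le> r\<close>)
        moreover have "norm (u + \<rho> *\<^sub>R n - q) \<le> norm (u - q) + \<rho>"
          using norm_triangle_ineq[of "u - q" "\<rho> *\<^sub>R n"] assms(3) \<rho>0 by (simp add: algebra_simps)
        ultimately show ?thesis
          by (simp add: dist_norm norm_minus_commute)
      qed
      then have "n \<bullet> (u + \<rho> *\<^sub>R n - p) \<le> 0"
        using assms(4) by (auto simp: normal_cone_def)
      then have "t * (n \<bullet> (x - p)) + \<rho> \<le> 0"
        using assms(3) by (simp add: u_def inner_simps norm_eq_1 algebra_simps)
      then have "t * (n \<bullet> (x - p) + s * (h / (2 * r))) \<le> 0"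
        by (simp add: \<rho>_def algebra_simps)
      then show ?thesis
        using t by (simp add: mult_le_0_iff)
    qed
    then have "h / (2 * r) \<le> - (n \<bullet> (x - p))"
      by (rule field_le_mult_one_interval)
    then have "h + 2 * r * (n \<bullet> (x - p)) \<le> 0"
      using r by (simp add: field_simps)
    moreover have "(x - (p - r *\<^sub>R n)) \<bullet> (x - (p - r *\<^sub>R n)) = h + 2 * r * (n \<bullet> (x - p)) + r\<^sup>2"
      using assms(3)
      by (simp add: h_def inner_simps inner_commute norm_eq_1 power2_eq_square algebra_simps)
    ultimately have "(norm (x - (p - r *\<^sub>R n)))\<^sup>2 \<le> r\<^sup>2"
      by (simp only: power2_norm_eq_inner)
    then have "norm (x - (p - r *\<^sub>R n)) \<le> r"
      by (rule power2_le_imp_le) (use r in simp)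
    then show ?thesis
      by (simp add: dist_norm norm_minus_commute)
  qed
qed

text \<open>
  For fixed \<open>y \<in> S\<close> the ball of radius \<open>d\<close> around \<open>y\<close> is convex and contains \<open>S\<close>, hence its hull;
  repeating the argument with \<open>y\<close> replaced by a point of the hull frees the other argument.
\<close>

lemma convex_hull_norm_diff_le:
  fixes S :: "'a::euclidean_space set"
  assumes S: "\<And>p q. p \<in> S \<Longrightarrow> q \<in> S \<Longrightarrow> norm (p - q) \<le> d"
    and "p \<in> convex hull S" "q \<in> convex hull S"
  shows "norm (p - q) \<le> d"
proof -
  have "convex hull S \<subseteq> cball y d" if "y \<in> S" for y
    using S[OF that] by (intro hull_minimal) (auto simp: dist_norm)
  then have "S \<subseteq> cball p d"
    using assms(2) by (force simp: dist_commute)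
  then have "convex hull S \<subseteq> cball p d"
    by (intro hull_minimal) auto
  then show ?thesis
    using assms(3) by (auto simp: dist_norm)
qed

section \<open>Necessity\<close>

lemma Interp_if_interpolable:
  fixes z v :: "'i \<Rightarrow> 'a::euclidean_space"
  assumes "\<alpha> \<le> \<beta>" "\<And>i. i \<in> I \<Longrightarrow> v i \<noteq> 0" "\<And>k. k \<in> K \<Longrightarrow> 0 \<le> \<delta> k"
    and "interpolable \<alpha> \<beta> D I z v K x \<delta>"
  shows "Interp \<alpha> \<beta> D 1 I z v K x \<delta>"
proof -
  obtain C where C: "closed C" "convex C" "strongly_convex_set \<alpha> C" "smooth_set \<beta> C" "ediam C \<le> D"
    and zC: "\<And>i. i \<in> I \<Longrightarrow> z i \<in> C" and vC: "\<And>i. i \<in> I \<Longrightarrow> v i \<in> normal_cone C (z i)"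
    and xC: "\<And>k. k \<in> K \<Longrightarrow> cball (x k) (\<delta> k) \<subseteq> C"
    using assms(4) by (auto simp: interpolable_def convex_class_def inner_parallel_def)
  define a where "a = recip \<alpha>"
  define b where "b = recip \<beta>"
  define n where "n = (\<lambda>i. (1 / norm (v i)) *\<^sub>R v i)"
  define s where "s = (\<lambda>k. max 0 (\<delta> k - b))"
  have b0: "0 \<le> b"
    by (simp add: b_def recip_nonneg)
  have s0: "0 \<le> s k" for k
    by (simp add: s_def)
  have n1: "norm (n i) = 1" if "i \<in> I" for i
    using assms(2)[OF that] by (simp add: n_def)
  have nC: "n i \<in> normal_cone C (z i)" if "i \<in> I" for i
    using vC[OF that] by (auto simp: n_def normal_cone_def divide_simps)
  have zF: "z i \<in> frontier C" if "i \<in> I" for i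
    using frontier_if_nonzero_normal zC vC assms(2) that by blast
  have inner: "cball (z i - b *\<^sub>R n i) b \<subseteq> C" if "i \<in> I" for i
    using C(4) zF[OF that] nC[OF that] n1[OF that] by (auto simp: smooth_set_def b_def)
  have outer: "C \<subseteq> cball (z i - a *\<^sub>R n i) a" if "i \<in> I" "\<alpha> \<noteq> 0" for i
  proof (cases "\<alpha> = \<infinity>")
    case True
    \<comment> \<open>Here \<open>a = 0\<close> and the enclosing ball degenerates to the only point of \<open>C\<close>.\<close>
    then obtain y where "C = {y}"
      using C(3) by (auto simp: strongly_convex_set_def)
    then show ?thesis
      using zC[OF that(1)] True by (simp add: a_def recip_def)
  next
    case False
    then show ?thesis
      using C(3) that zF nC n1 by (auto simp: strongly_convex_set_def a_def)
  qed
  \<comment> \<open>The supporting half-space takes the place of the enclosing ball if \<open>\<alpha> = 0\<close>.\<close>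
  have half: "n i \<bullet> (p + r *\<^sub>R n i - z i) \<le> 0" if "i \<in> I" "cball p r \<subseteq> C" "0 \<le> r" for i p r
  proof -
    have "p + r *\<^sub>R n i \<in> C"
      using that n1 by (auto simp: dist_norm subset_eq)
    then show ?thesis
      using nC[OF that(1)] by (simp add: normal_cone_def)
  qed
  \<comment> \<open>If \<open>\<delta>\<^sub>k > b\<close>, the ball of radius \<open>\<delta>\<^sub>k = b + s\<^sub>k\<close> around \<open>x\<^sub>k\<close> is already large enough.\<close>
  have "\<exists>w. cball w (b + s k) \<subseteq> C \<and> norm (x k - w) \<le> b - \<delta> k + s k" if k: "k \<in> K" for k
  proof (cases "\<delta> k \<le> b")
    case True
    obtain w where "cball w b \<subseteq> C" "norm (x k - w) \<le> b - \<delta> k"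
      using smooth_set_retreat[OF C(2,1,4) xC[OF k] assms(3)[OF k]] True
      unfolding b_def by blast
    then show ?thesis
      using True by (auto simp: s_def)
  next
    case False
    then show ?thesis
      using xC[OF that] by (auto simp: s_def)
  qed
  then obtain w where w: "\<And>k. k \<in> K \<Longrightarrow> cball (w k) (b + s k) \<subseteq> C"
    "\<And>k. k \<in> K \<Longrightarrow> norm (x k - w k) \<le> b - \<delta> k + s k"
    by metis
  have bs: "0 \<le> b + s k" for k
    using b0 s0[of k] by simp
  have zz: "if \<alpha> = 0 then n i \<bullet> (z j - b *\<^sub>R n j - z i + b *\<^sub>R n i) \<le> 0
      else norm (z i - a *\<^sub>R n i - (z j - b *\<^sub>R n j)) \<le> a - b" if "i \<in> I" "j \<in> I" for i j
    using half[OF that(1) inner[OF that(2)] b0]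
      inscribed_ball_centre[OF inner[OF that(2)] outer[OF that(1)] b0]
    by (simp add: algebra_simps)
  have zw: "if \<alpha> = 0 then n i \<bullet> (w k + s k *\<^sub>R n i - z i + b *\<^sub>R n i) \<le> 0
      else norm (z i - a *\<^sub>R n i - w k) \<le> a - b - s k" if "i \<in> I" "k \<in> K" for i k
    using half[OF that(1) w(1)[OF that(2)] bs]
      inscribed_ball_centre[OF w(1)[OF that(2)] outer[OF that(1)] bs]
    by (simp add: algebra_simps)
  have diam_zz: "norm (z i - b *\<^sub>R n i - (z j - b *\<^sub>R n j)) \<le> enn2real D - 2 * b"
    if "D < \<infinity>" "i \<in> I" "j \<in> I" for i j
    using inscribed_balls_ediam[OF inner[OF that(2)] inner[OF that(3)] b0 b0 C(5) that(1)] by simp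
  have diam_zw: "norm (z i - b *\<^sub>R n i - w k) \<le> enn2real D - 2 * b - s k"
    if "D < \<infinity>" "i \<in> I" "k \<in> K" for i k
    using inscribed_balls_ediam[OF inner[OF that(2)] w(1)[OF that(3)] b0 bs C(5) that(1)] by simp
  have diam_ww: "norm (w k - w l) \<le> enn2real D - 2 * b - s k - s l"
    if "D < \<infinity>" "k \<in> K" "l \<in> K" for k l
    using inscribed_balls_ediam[OF w(1)[OF that(2)] w(1)[OF that(3)] bs bs C(5) that(1)] by simp
  show ?thesis
    unfolding Interp_def Let_def a_def[symmetric] b_def[symmetric] mult_1
    using zz zw w(2) diam_zz diam_zw diam_ww unfolding n_def s_def by (intro exI[of _ w]) auto
qed

section \<open>Sufficiency\<close>

text \<open>
  The common part of all constructions: what is left to choose is a core \<open>C\<close> that makes the outer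
  parallel set strongly convex and of small diameter.
\<close>

lemma interpolable_if_core:
  fixes z v :: "'i \<Rightarrow> 'a::euclidean_space"
  assumes b: "b = recip \<beta>"
    and n1: "\<And>i. i \<in> I \<Longrightarrow> norm (n i) = 1"
    and vn: "\<And>i. i \<in> I \<Longrightarrow> v i = norm (v i) *\<^sub>R n i"
    and C: "C \<noteq> {}" "closed C" "convex C"
    and SC: "strongly_convex_set \<alpha> (outer_parallel b C)" "ediam (outer_parallel b C) \<le> D"
    and zC: "\<And>i. i \<in> I \<Longrightarrow> z i - b *\<^sub>R n i \<in> C"
    and nC: "\<And>i. i \<in> I \<Longrightarrow> n i \<in> normal_cone C (z i - b *\<^sub>R n i)"
    and wC: "\<And>k. k \<in> K \<Longrightarrow> cball (w k) (s k) \<subseteq> C"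
    and xw: "\<And>k. k \<in> K \<Longrightarrow> norm (x k - w k) \<le> b - \<delta> k + s k"
    and s0: "\<And>k. k \<in> K \<Longrightarrow> 0 \<le> s k"
  shows "interpolable \<alpha> \<beta> D I z v K x \<delta>"
proof -
  let ?C = "outer_parallel b C"
  have b0: "0 \<le> b"
    by (simp add: b recip_nonneg)
  have "?C \<noteq> {}"
    using C(1) b0 cball_subset_outer_parallel[of _ C b] by fastforce
  then have "?C \<in> convex_class \<alpha> \<beta> D"
    using C SC closed_outer_parallel convex_outer_parallel smooth_set_outer_parallel[of C \<beta>]
    by (auto simp: convex_class_def b)
  moreover have "z i \<in> ?C" if "i \<in> I" for i
    using zC[OF that] n1[OF that] b0 by (force simp: outer_parallel_def)
  moreover have "v i \<in> normal_cone ?C (z i)" if "i \<in> I" for i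
  proof -
    have "n i \<bullet> (y - z i) \<le> 0" if y: "y \<in> ?C" for y
    proof -
      obtain p where p: "p \<in> C" "norm (y - p) \<le> b"
        using y by (auto simp: outer_parallel_def)
      have "n i \<bullet> (y - p) \<le> b"
        using norm_cauchy_schwarz[of "n i" "y - p"] p(2) n1[OF \<open>i \<in> I\<close>] by simp
      moreover have "n i \<bullet> (p - (z i - b *\<^sub>R n i)) \<le> 0"
        using nC[OF \<open>i \<in> I\<close>] p(1) by (simp add: normal_cone_def)
      ultimately show ?thesis
        using n1[OF \<open>i \<in> I\<close>] by (simp add: inner_simps norm_eq_1)
    qed
    moreover have "v i \<bullet> y = norm (v i) * (n i \<bullet> y)" for y
      using vn[OF that] by (metis inner_scaleR_left)
    ultimately show ?thesis
      by (simp add: normal_cone_def mult_nonneg_nonpos)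
  qed
  moreover have "x k \<in> inner_parallel (\<delta> k) ?C" if k: "k \<in> K" for k
    unfolding inner_parallel_def
  proof (intro CollectI subsetI)
    fix y
    assume "y \<in> cball (x k) (\<delta> k)"
    then have y: "norm (y - w k) \<le> b + s k"
      using xw[OF k] norm_triangle_ineq[of "y - x k" "x k - w k"]
      by (simp add: dist_norm norm_minus_commute)
    show "y \<in> ?C"
    proof (cases "norm (y - w k) \<le> s k")
      case True
      then have "y \<in> C"
        using wC[OF k] by (auto simp: dist_norm norm_minus_commute)
      then show ?thesis
        using b0 by (force simp: outer_parallel_def)
    next
      case False
      \<comment> \<open>The point of the ball of radius \<open>s\<^sub>k\<close> nearest to \<open>y\<close> is on the segment from \<open>w\<^sub>k\<close> to \<open>y\<close>.\<close>
      let ?r = "norm (y - w k)"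
      let ?p = "w k + (s k / ?r) *\<^sub>R (y - w k)"
      have r: "0 < ?r"
        using False s0[OF k] by linarith
      then have "?p \<in> cball (w k) (s k)"
        using s0[OF k] by (simp add: dist_norm)
      then have "?p \<in> C"
        using wC[OF k] by auto
      have "y - ?p = (1 - s k / ?r) *\<^sub>R (y - w k)"
        by (simp add: algebra_simps)
      moreover have "0 \<le> 1 - s k / ?r"
        using r False by (simp add: field_simps)
      ultimately have "norm (y - ?p) = (1 - s k / ?r) * ?r"
        by (metis abs_of_nonneg norm_scaleR)
      also have "\<dots> = ?r - s k"
        using r by (simp add: left_diff_distrib)
      also have "\<dots> \<le> b"
        using y by simp
      finally show ?thesis
        using \<open>?p \<in> C\<close> by (auto simp: outer_parallel_def)
    qed
  qed
  ultimately show ?thesis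
    unfolding interpolable_def by blast
qed

text \<open>
  The conditions place the points \<open>z\<^sub>i - b n\<^sub>i\<close> and the balls \<open>B(w\<^sub>k, s\<^sub>k)\<close> in
  the core, the intersection of the balls \<open>B(z\<^sub>i - a n\<^sub>i, a - b)\<close>. Moreover \<open>z\<^sub>i - b n\<^sub>i\<close> is on the
  boundary of the \<open>i\<close>-th of these balls, with outer normal \<open>n\<^sub>i\<close>, so \<open>n\<^sub>i\<close> is normal to the core.
  If \<open>\<alpha> = \<infinity>\<close>, all radii vanish, and the outer parallel set is a single point.
\<close>

lemma interpolable_if_strongly_convex:
  fixes z v :: "'i \<Rightarrow> 'a::euclidean_space"
  assumes "\<alpha> \<le> \<beta>" "\<alpha> \<noteq> 0" "2 / \<alpha> \<le> D" "I \<noteq> {}"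
    and v: "\<And>i. i \<in> I \<Longrightarrow> v i \<noteq> 0"
    and interp: "Interp \<alpha> \<beta> D 1 I z v K x \<delta>"
  shows "interpolable \<alpha> \<beta> D I z v K x \<delta>"
proof -
  define a where "a = recip \<alpha>"
  define b where "b = recip \<beta>"
  define n where "n = (\<lambda>i. (1 / norm (v i)) *\<^sub>R v i)"
  define s where "s = (\<lambda>k. max 0 (\<delta> k - b))"
  obtain w where
    zz: "\<And>i j. i \<in> I \<Longrightarrow> j \<in> I \<Longrightarrow> norm (z i - a *\<^sub>R n i - (z j - b *\<^sub>R n j)) \<le> a - b"
    and zw: "\<And>i k. i \<in> I \<Longrightarrow> k \<in> K \<Longrightarrow> norm (z i - a *\<^sub>R n i - w k) \<le> a - b - s k"
    and xw: "\<And>k. k \<in> K \<Longrightarrow> norm (x k - w k) \<le> b - \<delta> k + s k"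
    using interp
    unfolding Interp_def Let_def if_not_P[OF assms(2)] a_def b_def n_def s_def
    by atomize_elim (erule ex_forward, elim conjE, intro conjI allI impI; blast)
  have s0: "0 \<le> s k" for k
    by (simp add: s_def)
  have n1: "norm (n i) = 1" if "i \<in> I" for i
    using v[OF that] by (simp add: n_def)
  have vn: "v i = norm (v i) *\<^sub>R n i" if "i \<in> I" for i
    using v[OF that] by (simp add: n_def)
  define Q where "Q = (\<lambda>i. z i - a *\<^sub>R n i) ` I"
  define C where "C = (\<Inter>q\<in>Q. cball q (a - b))"
  have b0: "0 \<le> b"
    by (simp add: b_def recip_nonneg)
  have ba: "b \<le> a"
    unfolding a_def b_def using assms(1,2) by (rule recip_antimono)
  obtain q where q: "q \<in> Q"
    using \<open>I \<noteq> {}\<close> by (auto simp: Q_def)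
  have zC: "z i - b *\<^sub>R n i \<in> C" if "i \<in> I" for i
    using zz that by (auto simp: C_def Q_def dist_norm)
  then have "C \<noteq> {}"
    using \<open>I \<noteq> {}\<close> by auto
  have C: "closed C" "convex C"
    by (auto simp: C_def intro!: closed_INT convex_INT)
  have sub: "C \<subseteq> cball q (a - b)"
    using q by (auto simp: C_def)
  show ?thesis
  proof (rule interpolable_if_core[OF b_def n1 vn \<open>C \<noteq> {}\<close> C _ _ zC _ _ xw s0])
    show "strongly_convex_set \<alpha> (outer_parallel b C)"
    proof (cases "\<alpha> = \<infinity>")
      case True
      then have "\<beta> = \<infinity>"
        using assms(1) by (simp add: top_unique)
      with True have "a = 0" "b = 0"
        by (simp_all add: a_def b_def recip_def)
      then have "C = {q}"
        using sub \<open>C \<noteq> {}\<close> by auto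
      then show ?thesis
        using True \<open>b = 0\<close> by (simp add: strongly_convex_set_def outer_parallel_def)
    next
      case False
      then have "\<alpha> < \<infinity>"
        by (simp add: less_top)
      have "C \<subseteq> cball (p - (recip \<alpha> - b) *\<^sub>R m) (recip \<alpha> - b)"
        if "p \<in> C" "norm m = 1" "m \<in> normal_cone C p" for p m
        using q that unfolding C_def a_def[symmetric]
        by (intro Inter_cball_strongly_convex) auto
      then show ?thesis
        using strongly_convex_set_outer_parallel[OF C(1) b0 \<open>\<alpha> < \<infinity>\<close>] by blast
    qed
    have "norm (p - p') \<le> 2 * (a - b)" if "p \<in> C" "p' \<in> C" for p p'
    proof -
      have "dist q p \<le> a - b" "dist q p' \<le> a - b"
        using sub that by auto
      then show ?thesis
        using dist_triangle3[of p p' q] by (simp add: dist_norm)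
    qed
    then have "ediam (outer_parallel b C) \<le> ennreal (2 * (a - b) + 2 * b)"
      by (rule ediam_outer_parallel)
    also have "\<dots> = 2 / \<alpha>"
      using ennreal_double_recip[OF assms(2)] by (simp add: a_def)
    also have "\<dots> \<le> D" by fact
    finally show "ediam (outer_parallel b C) \<le> D" .
    show "n i \<in> normal_cone C (z i - b *\<^sub>R n i)" if "i \<in> I" for i
      unfolding normal_cone_def
    proof (intro CollectI ballI)
      fix y
      assume "y \<in> C"
      then have "norm (y - (z i - a *\<^sub>R n i)) \<le> a - b"
        using that by (auto simp: C_def Q_def dist_norm norm_minus_commute)
      then have "n i \<bullet> (y - (z i - a *\<^sub>R n i)) \<le> a - b"
        using norm_cauchy_schwarz[of "n i" "y - (z i - a *\<^sub>R n i)"] n1[OF that] by simp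
      then show "n i \<bullet> (y - (z i - b *\<^sub>R n i)) \<le> 0"
        using n1[OF that] by (simp add: inner_simps norm_eq_1)
    qed
    show "cball (w k) (s k) \<subseteq> C" if "k \<in> K" for k
      unfolding C_def
    proof (rule INT_greatest)
      fix q
      assume "q \<in> Q"
      then have "norm (q - w k) \<le> a - b - s k"
        using zw that by (auto simp: Q_def)
      then show "cball (w k) (s k) \<subseteq> cball q (a - b)"
        by (simp add: cball_subset_cball_iff dist_norm norm_minus_commute)
    qed
  qed
qed

text \<open>
  The conditions say that the points \<open>z\<^sub>i - b n\<^sub>i\<close> and the balls \<open>B(w\<^sub>k, s\<^sub>k)\<close> lie in the half-space
  with outer normal \<open>n\<^sub>i\<close> at \<open>z\<^sub>i - b n\<^sub>i\<close>, and, if \<open>D < \<infinity>\<close>, that their union has diameter at most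
  \<open>D - 2 b\<close>; both properties carry over to the convex hull. The intersection of the half-spaces is not a suitable
  core, since it may be too wide.
\<close>

lemma interpolable_if_convex:
  fixes z v :: "'i \<Rightarrow> 'a::euclidean_space"
  assumes "finite I" "finite K" "I \<noteq> {} \<or> K \<noteq> {}"
    and v: "\<And>i. i \<in> I \<Longrightarrow> v i \<noteq> 0"
    and interp: "Interp 0 \<beta> D 1 I z v K x \<delta>"
  shows "interpolable 0 \<beta> D I z v K x \<delta>"
proof -
  define b where "b = recip \<beta>"
  define d where "d = enn2real D - 2 * b"
  define n where "n = (\<lambda>i. (1 / norm (v i)) *\<^sub>R v i)"
  define s where "s = (\<lambda>k. max 0 (\<delta> k - b))"
  obtain w where
    zz: "\<And>i j. i \<in> I \<Longrightarrow> j \<in> I \<Longrightarrow> n i \<bullet> (z j - b *\<^sub>R n j - z i + b *\<^sub>R n i) \<le> 0"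
    and zw: "\<And>i k. i \<in> I \<Longrightarrow> k \<in> K \<Longrightarrow> n i \<bullet> (w k + s k *\<^sub>R n i - z i + b *\<^sub>R n i) \<le> 0"
    and xw: "\<And>k. k \<in> K \<Longrightarrow> norm (x k - w k) \<le> b - \<delta> k + s k"
    and diam: "\<And>i j. D < \<infinity> \<Longrightarrow> i \<in> I \<Longrightarrow> j \<in> I \<Longrightarrow>
        norm (z i - b *\<^sub>R n i - (z j - b *\<^sub>R n j)) \<le> d"
      "\<And>i k. D < \<infinity> \<Longrightarrow> i \<in> I \<Longrightarrow> k \<in> K \<Longrightarrow> norm (z i - b *\<^sub>R n i - w k) \<le> d - s k"
      "\<And>k l. D < \<infinity> \<Longrightarrow> k \<in> K \<Longrightarrow> l \<in> K \<Longrightarrow> norm (w k - w l) \<le> d - s k - s l"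
    using interp unfolding Interp_def Let_def if_P[OF refl] mult_1 d_def b_def n_def s_def
    by atomize_elim (erule ex_forward, elim conjE, intro conjI allI impI; blast)
  have s0: "0 \<le> s k" for k
    by (simp add: s_def)
  have n1: "norm (n i) = 1" if "i \<in> I" for i
    using v[OF that] by (simp add: n_def)
  have vn: "v i = norm (v i) *\<^sub>R n i" if "i \<in> I" for i
    using v[OF that] by (simp add: n_def)
  define c where "c = (\<lambda>i. z i - b *\<^sub>R n i)"
  define S where "S = c ` I \<union> (\<Union>k\<in>K. cball (w k) (s k))"
  define C where "C = convex hull S"
  have "compact S"
    unfolding S_def using assms(1,2)
    by (intro compact_Un[OF finite_imp_compact compact_UN]) auto
  then have C: "closed C" "convex C"
    by (auto simp: C_def compact_convex_hull compact_imp_closed)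
  have SC: "S \<subseteq> C"
    by (simp add: C_def hull_subset)
  have cS: "c i \<in> S" if "i \<in> I" for i
    using that by (simp add: S_def)
  have "w k \<in> S" if "k \<in> K" for k
    using that s0[of k] unfolding S_def by (intro UnI2 UN_I[of k]) auto
  then have "C \<noteq> {}"
    using assms(3) cS SC by blast
  have zC: "z i - b *\<^sub>R n i \<in> C" if "i \<in> I" for i
    using cS[OF that] SC by (auto simp: c_def)
  show ?thesis
  proof (rule interpolable_if_core[OF b_def n1 vn \<open>C \<noteq> {}\<close> C _ _ zC _ _ xw s0])
    show "strongly_convex_set 0 (outer_parallel b C)"
      by (simp add: strongly_convex_set_def)
    show "ediam (outer_parallel b C) \<le> D"
    proof (cases "D < \<infinity>")
      case True
      have cc: "norm (p - q) \<le> d" if "p \<in> c ` I" "q \<in> c ` I" for p q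
        using diam(1)[OF True] that by (auto simp: c_def)
      have cb: "norm (p - q) \<le> d" if p: "p \<in> c ` I" and qk: "q \<in> cball (w k) (s k)" "k \<in> K" for p q k
      proof -
        obtain i where "i \<in> I" "p = c i"
          using p by auto
        then have "norm (p - w k) \<le> d - s k"
          using diam(2)[OF True] qk(2) by (auto simp: c_def)
        moreover have "norm (w k - q) \<le> s k"
          using qk(1) by (simp add: dist_norm)
        ultimately show ?thesis
          using norm_triangle_ineq[of "p - w k" "w k - q"] by simp
      qed
      have bb: "norm (p - q) \<le> d"
        if "p \<in> cball (w k) (s k)" "q \<in> cball (w l) (s l)" "k \<in> K" "l \<in> K" for p q k l
      proof -
        have "norm (p - w k) \<le> s k" "norm (w l - q) \<le> s l"
          using that(1,2) by (simp_all add: dist_norm norm_minus_commute)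
        then show ?thesis
          using diam(3)[OF True that(3,4)] norm_triangle_ineq[of "p - w k" "w k - w l"]
            norm_triangle_ineq[of "p - w l" "w l - q"] by simp
      qed
      have "norm (p - q) \<le> d" if "p \<in> S" "q \<in> S" for p q
        using that cc cb[of p q] cb[of q p] bb[of p _ q] unfolding S_def
        by (auto simp: norm_minus_commute)
      then have "norm (p - q) \<le> d" if "p \<in> C" "q \<in> C" for p q
        using convex_hull_norm_diff_le that unfolding C_def by blast
      then have "ediam (outer_parallel b C) \<le> ennreal (d + 2 * b)"
        by (rule ediam_outer_parallel)
      also have "\<dots> = D"
        using True by (simp add: d_def b_def)
      finally show ?thesis .
    next
      case False
      then show ?thesis by (simp add: less_top[symmetric])
    qed
    show "n i \<in> normal_cone C (z i - b *\<^sub>R n i)" if i: "i \<in> I" for i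
    proof -
      have "n i \<bullet> y \<le> n i \<bullet> c i" if "y \<in> S" for y
        using that unfolding S_def
      proof (elim UnE UN_E imageE)
        fix j
        assume "y = c j" and j: "j \<in> I"
        then show ?thesis
          using zz[OF i j] by (simp add: c_def inner_simps)
      next
        fix k
        assume k: "k \<in> K" and "y \<in> cball (w k) (s k)"
        then have "n i \<bullet> (y - w k) \<le> s k"
          using norm_cauchy_schwarz[of "n i" "y - w k"] n1[OF i]
          by (simp add: dist_norm norm_minus_commute)
        moreover have "n i \<bullet> n i = 1"
          using n1[OF i] by (simp add: norm_eq_1)
        ultimately show ?thesis
          using zw[OF i k] by (simp add: c_def inner_simps)
      qed
      then have "C \<subseteq> {y. n i \<bullet> y \<le> n i \<bullet> c i}"
        unfolding C_def by (intro hull_minimal) (auto simp: convex_halfspace_le)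
      then show ?thesis
        by (auto simp: normal_cone_def c_def inner_diff_right)
    qed
    show "cball (w k) (s k) \<subseteq> C" if "k \<in> K" for k
      using SC that by (auto simp: S_def)
  qed
qed

text \<open>The core is a single point, so that the set is a ball of radius \<open>1/\<beta>\<close>.\<close>

lemma interpolable_empty:
  fixes z v :: "'i \<Rightarrow> 'a::euclidean_space"
  assumes "\<alpha> \<le> \<beta>" "0 < \<beta>" "2 / \<beta> \<le> D"
  shows "interpolable \<alpha> \<beta> D {} z v {} x \<delta>"
proof (rule interpolable_if_core[where C = "{0}", OF refl])
  have "ediam (outer_parallel (recip \<beta>) {0 :: 'a}) \<le> ennreal (0 + 2 * recip \<beta>)"
    by (rule ediam_outer_parallel) simp
  also have "\<dots> \<le> D"
    using assms(2,3) ennreal_double_recip[of \<beta>] by simp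
  finally show "ediam (outer_parallel (recip \<beta>) {0 :: 'a}) \<le> D" .
  show "strongly_convex_set \<alpha> (outer_parallel (recip \<beta>) {0 :: 'a})"
  proof (cases "\<alpha> = 0 \<or> \<alpha> = \<infinity>")
    case True
    then show ?thesis
      using assms(1) by (auto simp: strongly_convex_set_def outer_parallel_def top_unique recip_def)
  next
    case False
    then show ?thesis
      using recip_antimono[OF assms(1)]
      by (intro strongly_convex_set_outer_parallel) (auto simp: recip_nonneg less_top)
  qed
qed auto

text \<open>The whole space has empty boundary, so that both curvature conditions hold vacuously.\<close>

lemma interpolable_UNIV:
  fixes z v :: "'i \<Rightarrow> 'a::euclidean_space"
  assumes "\<alpha> < \<infinity>"
  shows "interpolable \<alpha> \<beta> \<infinity> {} z v K x \<delta>"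
proof -
  have "(UNIV :: 'a set) \<in> convex_class \<alpha> \<beta> \<infinity>"
    using assms by (auto simp: convex_class_def strongly_convex_set_def smooth_set_def)
  then show ?thesis
    by (auto simp: interpolable_def inner_parallel_def)
qed

theorem theorem3p3:
  fixes \<alpha> \<beta> D :: ennreal
    and I :: "'i set" and z v :: "'i \<Rightarrow> 'a::euclidean_space"
    and K :: "'k set" and x :: "'k \<Rightarrow> 'a" and \<delta> :: "'k \<Rightarrow> real"
  assumes "\<alpha> \<le> \<beta>" and "0 < \<beta>"
    and "finite I" and "finite K"
    and "\<And>i. i \<in> I \<Longrightarrow> v i \<noteq> 0"
    and "\<And>k. k \<in> K \<Longrightarrow> 0 \<le> \<delta> k"
    and "\<alpha> = 0 \<or> 2 / \<alpha> \<le> D"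
    and "I = {} \<Longrightarrow> K = {} \<Longrightarrow> 2 / \<beta> \<le> D"
    and "I = {} \<Longrightarrow> K \<noteq> {} \<Longrightarrow> \<alpha> = 0 \<or> (\<alpha> < \<infinity> \<and> D = \<infinity>)"
  shows "interpolable \<alpha> \<beta> D I z v K x \<delta> \<longleftrightarrow> Interp \<alpha> \<beta> D 1 I z v K x \<delta>"
proof
  assume "interpolable \<alpha> \<beta> D I z v K x \<delta>"
  then show "Interp \<alpha> \<beta> D 1 I z v K x \<delta>"
    using Interp_if_interpolable[of \<alpha> \<beta> I v K \<delta> D z x] assms(1,5,6) by blast
next
  assume *: "Interp \<alpha> \<beta> D 1 I z v K x \<delta>"
  consider (none) "I = {}" "K = {}" | (whole) "I = {}" "\<alpha> < \<infinity>" "D = \<infinity>"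
    | (convex) "\<alpha> = 0" "I \<noteq> {} \<or> K \<noteq> {}" | (strong) "\<alpha> \<noteq> 0" "I \<noteq> {}"
    using assms(9) by blast
  then show "interpolable \<alpha> \<beta> D I z v K x \<delta>"
  proof cases
    case none
    then show ?thesis
      using interpolable_empty assms(1,2,8) by simp
  next
    case whole
    then show ?thesis
      using interpolable_UNIV by simp
  next
    case convex
    then show ?thesis
      using interpolable_if_convex[of I K v \<beta> D z x \<delta>] assms(3-5) * by blast
  next
    case strong
    then show ?thesis
      using interpolable_if_strongly_convex[of \<alpha> \<beta> D I v z K x \<delta>] assms(1,5,7) * by blast
  qed
qed

end
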